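(* Let $f$ be a relation on a uniform space $(X,\mathcal U)$. If $L$ is a Lyapunov function for $f$, then $L$ is a Lyapunov function for $\mathcal Gf$. If $L$ is a uniformly continuous Lyapunov function for $f$, then $L$ is a Lyapunov function for $\mathcal A_{\mathcal U}f$.
   Context: A relation on $X$ is a subset of $X\times X$. A Lyapunov function for a relation $f$ is a continuous map $L:X\to\mathbb R$ such that $(x,y)\in f$ implies $L(x)\le L(y)$. $\mathcal Gf$ is the smallest closed (in $X\times X$) transitive relation on $X$ containing $f$. The gage $\Gamma(\mathcal U)$ is the set of all bounded pseudo-metrics $d$ on $X$ with $\{(x,y):d(x,y)<\epsilon\}\in\mathcal U$ for every $\epsilon>0$. $\mathcal A_{\mathcal U}f$ is the set of pairs $(x,y)$ such that for every $d\in\Gamma(\mathcal U)$ and $\epsilon>0$ there are $n\ge1$ and $(a_1,b_1),\dots,(a_n,b_n)\in f$ with $d(x,a_1)+\sum_{i=1}^{n-1}d(b_i,a_{i+1})+d(b_n,y)<\epsilon$. Uniform continuity of $L$ is from $(X,\mathcal U)$ to $\mathbb R$ with its usual uniformity. *)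

theory Defs
  imports "HOL-Analysis.Analysis"
begin

text \<open>
  The space is the type \<open>'a\<close>; its uniformity (the filter of entourages) is
  \<^const>\<open>uniformity\<close> of class \<^class>\<open>uniform_space\<close>, which does not assume the Hausdorff axiom
  and carries the topology induced by the uniformity.  A relation is any set of pairs.
\<close>

definition lyapunov_function :: "('a::topological_space) rel \<Rightarrow> ('a \<Rightarrow> real) \<Rightarrow> bool" where
  "lyapunov_function f L \<longleftrightarrow>
     continuous_on UNIV L \<and> (\<forall>x y. (x, y) \<in> f \<longrightarrow> L x \<le> L y)"

definition closed_trans_hull :: "('a::topological_space) rel \<Rightarrow> 'a rel" where
  "closed_trans_hull f = \<Inter> {g. f \<subseteq> g \<and> closed g \<and> trans g}"

text \<open>The intersection is itself such a relation, hence the smallest one:\<close>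

lemma closed_trans_hull_smallest:
  shows "f \<subseteq> closed_trans_hull f"
    and "closed (closed_trans_hull f)"
    and "trans (closed_trans_hull f)"
    and "\<And>g. f \<subseteq> g \<Longrightarrow> closed g \<Longrightarrow> trans g \<Longrightarrow> closed_trans_hull f \<subseteq> g"
proof -
  show "f \<subseteq> closed_trans_hull f"
    unfolding closed_trans_hull_def by blast
  show "closed (closed_trans_hull f)"
    unfolding closed_trans_hull_def by (intro closed_Inter) blast
  show "trans (closed_trans_hull f)"
    unfolding closed_trans_hull_def by (rule transI) (blast dest: transD)
  show "\<And>g. f \<subseteq> g \<Longrightarrow> closed g \<Longrightarrow> trans g \<Longrightarrow> closed_trans_hull f \<subseteq> g"
    unfolding closed_trans_hull_def by blast
qed

definition pseudo_metric :: "('a \<Rightarrow> 'a \<Rightarrow> real) \<Rightarrow> bool" where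
  "pseudo_metric d \<longleftrightarrow>
     (\<forall>x y. 0 \<le> d x y) \<and> (\<forall>x. d x x = 0) \<and> (\<forall>x y. d x y = d y x) \<and>
     (\<forall>x y z. d x z \<le> d x y + d y z)"

text \<open>
  For a filter \<open>F\<close>, a set \<open>V\<close> belongs to \<open>F\<close> iff \<open>eventually (\<lambda>p. p \<in> V) F\<close>.
\<close>

definition gage :: "('a::uniform_space \<Rightarrow> 'a \<Rightarrow> real) set" where
  "gage = {d. pseudo_metric d \<and> (\<exists>M. \<forall>x y. d x y \<le> M) \<and>
     (\<forall>\<epsilon>>0. eventually (\<lambda>p. p \<in> {(x, y). d x y < \<epsilon>}) uniformity)}"

definition chain_rel :: "('a::uniform_space) rel \<Rightarrow> 'a rel" where
  "chain_rel f = {(x, y). \<forall>d\<in>gage. \<forall>\<epsilon>>0. \<exists>n\<ge>1. \<exists>a b :: nat \<Rightarrow> 'a.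
     (\<forall>i\<in>{1..n}. (a i, b i) \<in> f) \<and>
     d x (a 1) + (\<Sum>i=1..<n. d (b i) (a (i + 1))) + d (b n) y < \<epsilon>}"

end

theory Submission
  imports Defs
begin

text \<open>
  For a continuous \<open>L\<close> the relation \<open>{(x, y). L x \<le> L y}\<close> is closed and transitive, so it contains
  \<open>\<G>f\<close> as soon as it contains \<open>f\<close>.  For the chain relation, suppose \<open>L y < L x\<close> and truncate \<open>L\<close> to
  the interval \<open>[L y, L x]\<close>.  The truncation \<open>K\<close> is bounded, uniformly continuous and nondecreasing
  along \<open>f\<close>, so \<open>\<bar>K u - K v\<bar>\<close> belongs to the gage; by telescoping, every chain from \<open>x\<close> to \<open>y\<close> has
  length at least \<open>K x - K y = L x - L y > 0\<close> in this pseudo-metric.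
\<close>

lemma closed_trans_hull_le:
  fixes L :: "'a::topological_space \<Rightarrow> real"
  assumes "lyapunov_function f L" "(x, y) \<in> closed_trans_hull f"
  shows "L x \<le> L y"
proof -
  let ?g = "{p. L (fst p) \<le> L (snd p)}"
  have L: "continuous_on UNIV L" "f \<subseteq> ?g"
    using assms(1) by (auto simp: lyapunov_function_def)
  have "closed ?g"
    by (intro closed_Collect_le continuous_on_compose2[OF L(1)] continuous_intros) auto
  moreover have "trans ?g"
    by (auto intro!: transI)
  ultimately have "closed_trans_hull f \<subseteq> ?g"
    using L(2) by (intro closed_trans_hull_smallest(4))
  then show ?thesis
    using assms(2) by auto
qed

text \<open>The metric of the reals is pulled back along \<open>K\<close>: uniform continuity turns
  its entourages into entourages of the space. The bounds \<open>l\<close> and \<open>r\<close>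
  supply the boundedness that \<open>gage\<close> demands.\<close>

lemma abs_diff_in_gage:
  fixes K :: "'a::uniform_space \<Rightarrow> real"
  assumes "uniformly_continuous_on UNIV K" "\<And>u. l \<le> K u" "\<And>u. K u \<le> r"
  shows "(\<lambda>u v. \<bar>K u - K v\<bar>) \<in> gage"
proof -
  have "\<bar>K u - K v\<bar> \<le> r - l" for u v
    using assms(2)[of u] assms(2)[of v] assms(3)[of u] assms(3)[of v] by linarith
  moreover have "eventually (\<lambda>p. p \<in> {(u, v). \<bar>K u - K v\<bar> < e}) uniformity" if "e > 0" for e
  proof -
    have "eventually (\<lambda>(s, t). dist s t < e) (uniformity :: (real \<times> real) filter)"
      using that by (auto simp: eventually_uniformity_metric)
    then have "eventually (\<lambda>(u, v). dist (K u) (K v) < e) uniformity"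
      using uniformly_continuous_onD[OF assms(1)] by fastforce
    then show ?thesis
      by (simp add: dist_real_def case_prod_unfold)
  qed
  ultimately show ?thesis
    by (auto simp: gage_def pseudo_metric_def)
qed

lemma diff_le_chain_length:
  fixes K :: "'a \<Rightarrow> real" and a b :: "nat \<Rightarrow> 'a"
  assumes "n \<ge> 1" "\<And>i. i \<in> {1..n} \<Longrightarrow> K (a i) \<le> K (b i)"
  shows "K x - K y \<le>
    \<bar>K x - K (a 1)\<bar> + (\<Sum>i=1..<n. \<bar>K (b i) - K (a (i + 1))\<bar>) + \<bar>K (b n) - K y\<bar>"
proof -
  \<comment> \<open>The final jump to \<open>y\<close> is left out of the induction. Passing from
    \<open>n\<close> to \<open>Suc n\<close> then only appends the jump from \<open>b n\<close> to
    \<open>a (Suc n)\<close>, after which \<open>K\<close> does not decrease up to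
    \<open>b (Suc n)\<close>.\<close>
  have "K x - K (b n) \<le> \<bar>K x - K (a 1)\<bar> + (\<Sum>i=1..<n. \<bar>K (b i) - K (a (i + 1))\<bar>)"
    using assms
  proof (induction n rule: nat_induct_at_least)
    case base
    then show ?case by force
  next
    case (Suc n)
    have "K x - K (b n) \<le> \<bar>K x - K (a 1)\<bar> + (\<Sum>i=1..<n. \<bar>K (b i) - K (a (i + 1))\<bar>)"
      using Suc by simp
    moreover have "K (a (Suc n)) \<le> K (b (Suc n))"
      using Suc.prems by simp
    ultimately show ?case
      using Suc.hyps by simp
  qed
  then show ?thesis
    by linarith
qed

lemma chain_rel_le:
  fixes L :: "'a::uniform_space \<Rightarrow> real"
  assumes "\<And>u v. (u, v) \<in> f \<Longrightarrow> L u \<le> L v" "uniformly_continuous_on UNIV L"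
    and "(x, y) \<in> chain_rel f"
  shows "L x \<le> L y"
proof (rule ccontr)
  assume "\<not> L x \<le> L y"
  then have less: "L y < L x" by simp
  define c where "c t = max (L y) (min (L x) t)" for t
  define K where "K u = c (L u)" for u
  \<comment> \<open>Clamping is 1-Lipschitz, so delta = epsilon witnesses uniform
    continuity.\<close>
  have "\<bar>c s - c t\<bar> \<le> \<bar>s - t\<bar>" for s t
    unfolding c_def by linarith
  then have "uniformly_continuous_on (range L) c"
    unfolding uniformly_continuous_on_def dist_real_def by (meson le_less_trans)
  with assms(2) have "uniformly_continuous_on UNIV K"
    unfolding K_def by (rule uniformly_continuous_on_compose)
  then have d: "(\<lambda>u v. \<bar>K u - K v\<bar>) \<in> gage"
    using less by (intro abs_diff_in_gage[of K "L y" "L x"]) (auto simp: K_def c_def)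
  have pos: "L x - L y > 0"
    using less by simp
  \<comment> \<open>The tolerance is the gap \<open>L x - L y\<close> itself, exactly the lower
    bound for the length of a chain.\<close>
  obtain n and a b :: "nat \<Rightarrow> 'a" where "n \<ge> 1" and ab: "\<forall>i\<in>{1..n}. (a i, b i) \<in> f"
    and small: "\<bar>K x - K (a 1)\<bar> + (\<Sum>i=1..<n. \<bar>K (b i) - K (a (i + 1))\<bar>) + \<bar>K (b n) - K y\<bar>
      < L x - L y"
    using assms(3)[unfolded chain_rel_def mem_Collect_eq case_prod_conv, rule_format, OF d pos]
    by blast
  have "K (a i) \<le> K (b i)" if "i \<in> {1..n}" for i
    using assms(1)[OF bspec[OF ab that]] unfolding K_def c_def by linarith
  from diff_le_chain_length[of n K a b x y, OF \<open>n \<ge> 1\<close> this] small have "K x - K y < L x - L y"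
    by linarith
  \<comment> \<open>Clamping fixes both ends of the interval, so \<open>K x = L x\<close> and
    \<open>K y = L y\<close>.\<close>
  then show False
    using less by (simp add: K_def c_def)
qed

theorem theorem5p9:
  fixes f :: "('a::uniform_space) rel" and L :: "'a \<Rightarrow> real"
  shows "(lyapunov_function f L \<longrightarrow> lyapunov_function (closed_trans_hull f) L) \<and>
         (lyapunov_function f L \<and> uniformly_continuous_on UNIV L \<longrightarrow>
            lyapunov_function (chain_rel f) L)"
proof (intro conjI impI)
  assume "lyapunov_function f L"
  then show "lyapunov_function (closed_trans_hull f) L"
    using closed_trans_hull_le lyapunov_function_def by blast
next
  assume "lyapunov_function f L \<and> uniformly_continuous_on UNIV L"
  then have "continuous_on UNIV L" "\<And>u v. (u, v) \<in> f \<Longrightarrow> L u \<le> L v" "uniformly_continuous_on UNIV L"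
    by (simp_all add: lyapunov_function_def)
  then show "lyapunov_function (chain_rel f) L"
    unfolding lyapunov_function_def by (blast intro: chain_rel_le)
qed

end
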